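(* For any positive, even integer $k$, the automorphism group of the directed graph $G(k,2,-1)$ is isomorphic to $\mathrm{Aff}(\mathbb{Z}/k\mathbb{Z})$, that is, to $\mathbb{Z}/k\mathbb{Z}\rtimes(\mathbb{Z}/k\mathbb{Z})^{\times}$.
   Context: For an even positive integer $k$, the directed graph $G(k,2,-1)$ (loops allowed) has vertex set $\mathbb{Z}/k\mathbb{Z}\times\mathbb{Z}/k\mathbb{Z}$, and its edges are all the directed edges $(p,i)\to(p+(-1)^j i,\,j)$ with $p,i,j\in\mathbb{Z}/k\mathbb{Z}$; $(-1)^j$ is well defined for $j\in\mathbb{Z}/k\mathbb{Z}$ because $k$ is even. $\mathrm{Aff}(\mathbb{Z}/k\mathbb{Z})$ is the group under composition of the maps $x\mapsto mx+b$ on $\mathbb{Z}/k\mathbb{Z}$ with $m\in(\mathbb{Z}/k\mathbb{Z})^\times$ and $b\in\mathbb{Z}/k\mathbb{Z}$; in the semidirect product, $(\mathbb{Z}/k\mathbb{Z})^{\times}$ acts on $\mathbb{Z}/k\mathbb{Z}$ by multiplication. *)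

theory Defs
  imports
    "Graph_Theory.Pair_Digraph"
    "HOL-Algebra.Bij"
    "HOL-Number_Theory.Residues"
begin

definition digraph_automorphisms :: "'a pair_pre_digraph \<Rightarrow> ('a \<Rightarrow> 'a) set" where
  "digraph_automorphisms D =
    {f \<in> Bij (pverts D).
      \<forall>u\<in>pverts D. \<forall>v\<in>pverts D. (u, v) \<in> parcs D \<longleftrightarrow> (f u, f v) \<in> parcs D}"

definition digraph_aut_group :: "'a pair_pre_digraph \<Rightarrow> ('a \<Rightarrow> 'a) monoid" where
  "digraph_aut_group D = BijGroup (pverts D)\<lparr>carrier := digraph_automorphisms D\<rparr>"

(* The digraph G(k,2,-1), with Z/kZ represented by {0..k-1} as in residue_ring.
   The sign depends on the representative j only through its parity, so it is
   the intended function of the residue class of j when k is even. *)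
definition G_digraph :: "nat \<Rightarrow> (int \<times> int) pair_pre_digraph" where
  "G_digraph k = (let Zk = carrier (residue_ring (int k)) in
    \<lparr>pverts = Zk \<times> Zk,
     parcs = {((p, i), ((p + (-1) ^ nat j * i) mod int k, j)) | p i j.
               p \<in> Zk \<and> i \<in> Zk \<and> j \<in> Zk}\<rparr>)"

definition affine_maps :: "('a, 'b) ring_scheme \<Rightarrow> ('a \<Rightarrow> 'a) set" where
  "affine_maps R =
    {(\<lambda>x\<in>carrier R. m \<otimes>\<^bsub>R\<^esub> x \<oplus>\<^bsub>R\<^esub> b) | m b. m \<in> Units R \<and> b \<in> carrier R}"

definition affine_group :: "('a, 'b) ring_scheme \<Rightarrow> ('a \<Rightarrow> 'a) monoid" where
  "affine_group R = BijGroup (carrier R)\<lparr>carrier := affine_maps R\<rparr>"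

definition semidirect_product ::
    "('a, 'c) monoid_scheme \<Rightarrow> ('b, 'd) monoid_scheme \<Rightarrow> ('b \<Rightarrow> 'a \<Rightarrow> 'a) \<Rightarrow> ('a \<times> 'b) monoid" where
  "semidirect_product N H \<phi> =
    \<lparr>carrier = carrier N \<times> carrier H,
     mult = (\<lambda>(n, h) (n', h'). (n \<otimes>\<^bsub>N\<^esub> \<phi> h n', h \<otimes>\<^bsub>H\<^esub> h')),
     one = (\<one>\<^bsub>N\<^esub>, \<one>\<^bsub>H\<^esub>)\<rparr>"

lemma digraph_automorphisms_subgroup:
  "subgroup (digraph_automorphisms D) (BijGroup (pverts D))"
proof -
  let ?V = "pverts D"
  interpret B: group "BijGroup ?V" by (rule group_BijGroup)
  show ?thesis
  proof (rule B.subgroupI)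
    show "digraph_automorphisms D \<subseteq> carrier (BijGroup ?V)"
      by (auto simp: digraph_automorphisms_def BijGroup_def)
    have "(\<lambda>x\<in>?V. x) \<in> digraph_automorphisms D"
      by (auto simp: digraph_automorphisms_def id_Bij)
    then show "digraph_automorphisms D \<noteq> {}" by blast
  next
    fix f assume f: "f \<in> digraph_automorphisms D"
    then have fB: "f \<in> Bij ?V" by (simp add: digraph_automorphisms_def)
    have inv: "inv\<^bsub>BijGroup ?V\<^esub> f = (\<lambda>x\<in>?V. inv_into ?V f x)"
      using fB by (rule inv_BijGroup)
    have bij: "bij_betw f ?V ?V" using fB by (simp add: Bij_def)
    have "(u, v) \<in> parcs D \<longleftrightarrow> (inv_into ?V f u, inv_into ?V f v) \<in> parcs D"
      if uv: "u \<in> ?V" "v \<in> ?V" for u v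
    proof -
      have "inv_into ?V f u \<in> ?V" "inv_into ?V f v \<in> ?V"
        using fB uv by (auto intro: Bij_inv_into_mem)
      moreover have "f (inv_into ?V f u) = u" "f (inv_into ?V f v) = v"
        using bij uv by (auto intro: bij_betw_inv_into_right)
      ultimately show ?thesis using f by (auto simp: digraph_automorphisms_def)
    qed
    then show "inv\<^bsub>BijGroup ?V\<^esub> f \<in> digraph_automorphisms D"
      using restrict_inv_into_Bij[OF fB] by (simp add: inv digraph_automorphisms_def)
  next
    fix f g assume fg: "f \<in> digraph_automorphisms D" "g \<in> digraph_automorphisms D"
    then have B: "f \<in> Bij ?V" "g \<in> Bij ?V" by (auto simp: digraph_automorphisms_def)
    then have "g x \<in> ?V" if "x \<in> ?V" for x using that by (auto dest: Bij_imp_funcset)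
    with fg B show "f \<otimes>\<^bsub>BijGroup ?V\<^esub> g \<in> digraph_automorphisms D"
      by (auto simp: BijGroup_def digraph_automorphisms_def compose_Bij compose_eq)
  qed
qed

lemma group_digraph_aut_group: "group (digraph_aut_group D)"
  unfolding digraph_aut_group_def
  by (rule subgroup.subgroup_is_group[OF digraph_automorphisms_subgroup group_BijGroup])

lemma pair_wf_digraph_G_digraph: "k > 0 \<Longrightarrow> pair_wf_digraph (G_digraph k)"
  by unfold_locales (auto simp: G_digraph_def residue_ring_def Let_def)

lemma (in cring) affine_maps_subgroup:
  "subgroup (affine_maps R) (BijGroup (carrier R))"
proof -
  interpret B: group "BijGroup (carrier R)" by (rule group_BijGroup)
  define aff where "aff m b = (\<lambda>x\<in>carrier R. m \<otimes> x \<oplus> b)" for m b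
  have aff_maps: "affine_maps R = {aff m b | m b. m \<in> Units R \<and> b \<in> carrier R}"
    by (simp add: affine_maps_def aff_def)
  have affI: "aff m b \<in> affine_maps R" if "m \<in> Units R" "b \<in> carrier R" for m b
    using that by (auto simp: aff_maps)
  have comp: "compose (carrier R) (aff m b) (aff n c) = aff (m \<otimes> n) (m \<otimes> c \<oplus> b)"
    if "m \<in> carrier R" "b \<in> carrier R" "n \<in> carrier R" "c \<in> carrier R" for m b n c
    using that by (auto simp: compose_def aff_def fun_eq_iff r_distr m_assoc a_assoc)
  have one: "aff \<one> \<zero> = (\<lambda>x\<in>carrier R. x)"
    by (auto simp: aff_def fun_eq_iff)
  have closed: "aff m b x \<in> carrier R" if "m \<in> carrier R" "b \<in> carrier R" "x \<in> carrier R" for m b x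
    using that by (simp add: aff_def)
  have linv: "compose (carrier R) (aff (inv m) (\<ominus> (inv m \<otimes> b))) (aff m b) = (\<lambda>x\<in>carrier R. x)"
    if "m \<in> Units R" "b \<in> carrier R" for m b
    using that by (simp add: comp one[symmetric] Units_closed r_neg)
  have rinv: "compose (carrier R) (aff m b) (aff (inv m) (\<ominus> (inv m \<otimes> b))) = (\<lambda>x\<in>carrier R. x)"
    if "m \<in> Units R" "b \<in> carrier R" for m b
    using that
    by (simp add: comp one[symmetric] Units_closed r_minus l_neg m_assoc[symmetric])
  have Bij: "aff m b \<in> Bij (carrier R)" if mb: "m \<in> Units R" "b \<in> carrier R" for m b
  proof -
    let ?g = "aff (inv m) (\<ominus> (inv m \<otimes> b))"
    have "?g (aff m b x) = x" "aff m b (?g x) = x" if "x \<in> carrier R" for x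
      using fun_cong[OF linv[OF mb], of x] fun_cong[OF rinv[OF mb], of x] that
      by (simp_all add: compose_def)
    then have "bij_betw (aff m b) (carrier R) (carrier R)"
      using mb by (intro bij_betw_byWitness[where f' = ?g]) (auto intro!: closed)
    then show ?thesis by (simp add: Bij_def aff_def)
  qed
  show ?thesis
  proof (rule B.subgroupI)
    show "affine_maps R \<subseteq> carrier (BijGroup (carrier R))"
      using Bij by (auto simp: aff_maps BijGroup_def)
    show "affine_maps R \<noteq> {}" by (auto simp: aff_maps)
  next
    fix f assume "f \<in> affine_maps R"
    then obtain m b where f: "f = aff m b" and mb: "m \<in> Units R" "b \<in> carrier R"
      by (auto simp: aff_maps)
    let ?g = "aff (inv m) (\<ominus> (inv m \<otimes> b))"
    have gB: "?g \<in> Bij (carrier R)" using mb by (intro Bij) auto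
    have "inv\<^bsub>BijGroup (carrier R)\<^esub> f = ?g"
      by (rule B.inv_equality) (use Bij[OF mb] gB linv[OF mb] in \<open>simp_all add: f BijGroup_def\<close>)
    then show "inv\<^bsub>BijGroup (carrier R)\<^esub> f \<in> affine_maps R"
      using mb by (simp add: affI)
  next
    fix f g assume "f \<in> affine_maps R" "g \<in> affine_maps R"
    then obtain m b n c where
      fg: "f = aff m b" "g = aff n c" "m \<in> Units R" "b \<in> carrier R" "n \<in> Units R" "c \<in> carrier R"
      by (auto simp: aff_maps)
    then have "f \<otimes>\<^bsub>BijGroup (carrier R)\<^esub> g = aff (m \<otimes> n) (m \<otimes> c \<oplus> b)"
      by (simp add: BijGroup_def Bij comp Units_closed)
    then show "f \<otimes>\<^bsub>BijGroup (carrier R)\<^esub> g \<in> affine_maps R"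
      using fg by (simp add: affI Units_closed)
  qed
qed

lemma (in cring) group_affine_group: "group (affine_group R)"
  unfolding affine_group_def
  by (rule subgroup.subgroup_is_group[OF affine_maps_subgroup group_BijGroup])

lemma group_semidirect_product:
  assumes "group N" and "group H"
    and hom: "\<And>h. h \<in> carrier H \<Longrightarrow> \<phi> h \<in> hom N N"
    and act_one: "\<And>n. n \<in> carrier N \<Longrightarrow> \<phi> \<one>\<^bsub>H\<^esub> n = n"
    and act_mult: "\<And>h h' n. h \<in> carrier H \<Longrightarrow> h' \<in> carrier H \<Longrightarrow> n \<in> carrier N \<Longrightarrow>
      \<phi> (h \<otimes>\<^bsub>H\<^esub> h') n = \<phi> h (\<phi> h' n)"
  shows "group (semidirect_product N H \<phi>)"
proof -
  interpret N: group N by fact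
  interpret H: group H by fact
  have cl: "\<phi> h n \<in> carrier N" if "h \<in> carrier H" "n \<in> carrier N" for h n
    using hom[OF that(1)] that(2) by (auto simp: hom_def)
  have mult: "\<phi> h (n \<otimes>\<^bsub>N\<^esub> n') = \<phi> h n \<otimes>\<^bsub>N\<^esub> \<phi> h n'"
    if "h \<in> carrier H" "n \<in> carrier N" "n' \<in> carrier N" for h n n'
    using hom[OF that(1)] that(2,3) by (auto simp: hom_def)
  show ?thesis
  proof (rule groupI)
    fix x assume "x \<in> carrier (semidirect_product N H \<phi>)"
    then obtain n h where x: "x = (n, h)" and nh: "n \<in> carrier N" "h \<in> carrier H"
      by (auto simp: semidirect_product_def)
    let ?y = "(\<phi> (inv\<^bsub>H\<^esub> h) (inv\<^bsub>N\<^esub> n), inv\<^bsub>H\<^esub> h)"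
    have "\<phi> (inv\<^bsub>H\<^esub> h) (inv\<^bsub>N\<^esub> n) \<otimes>\<^bsub>N\<^esub> \<phi> (inv\<^bsub>H\<^esub> h) n = \<phi> (inv\<^bsub>H\<^esub> h) \<one>\<^bsub>N\<^esub>"
      using nh by (simp add: mult[symmetric])
    also have "\<dots> = \<one>\<^bsub>N\<^esub>"
      using hom_one[OF hom \<open>group N\<close> \<open>group N\<close>] nh by simp
    finally show "\<exists>y\<in>carrier (semidirect_product N H \<phi>).
        y \<otimes>\<^bsub>semidirect_product N H \<phi>\<^esub> x = \<one>\<^bsub>semidirect_product N H \<phi>\<^esub>"
      using nh cl by (intro bexI[of _ ?y]) (auto simp: x semidirect_product_def)
  qed (auto simp: semidirect_product_def cl mult act_one act_mult N.m_assoc H.m_assoc)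
qed

end

theory Submission
  imports Defs
begin

text \<open>
  All coordinates are modulo \<open>k\<close>. For a unit \<open>m\<close> and any \<open>b\<close>, the map
  \<open>(p, i) \<mapsto> (b + m p, m i)\<close> is an automorphism: it carries \<open>p + (-1)\<^sup>j i\<close> to
  \<open>b + m p + (-1)\<^sup>j m i\<close>, and \<open>m j\<close> has the parity of \<open>j\<close> because a unit modulo an even
  number is odd. This gives an injective homomorphism from the semidirect product
  (\<open>lift\<close>, with \<open>lift_automorphism\<close>), and all the content lies in its surjectivity
  (\<open>automorphism_is_lift\<close>).

  To recover \<open>b\<close> and \<open>m\<close> from an automorphism \<open>\<phi>\<close>, one reads the coordinates off the digraph.
  The in-neighbours of \<open>(q, j)\<close> form the antidiagonal \<open>a + x = q\<close> for even \<open>j\<close> and the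
  diagonal \<open>a - x = q\<close> for odd \<open>j\<close>. Two parallel lines meet only if they are equal; a diagonal
  and an antidiagonal meet exactly when their offsets have the same parity, since \<open>k\<close> is even
  (\<open>common_in_iff\<close>). Going through one intermediate vertex, the relation of having a common
  in-neighbour therefore detects whether the first coordinates of two vertices have the same
  parity (\<open>linked_iff\<close>). Along an arc from \<open>(p, i)\<close> the first coordinate changes by
  \<open>\<plusminus>i\<close>, so the parity of the second coordinate is also visible (\<open>arc_linked_iff\<close>) and \<open>\<phi>\<close>
  preserves it. Among vertices whose second coordinates have equal parity, a common
  in-neighbour means equal first coordinates, so the first coordinate of \<open>\<phi> (p, i)\<close> depends
  on \<open>p\<close> and the parity of \<open>i\<close> only.

  Comparing the two arcs from \<open>(p, 0)\<close> to \<open>(p, 0)\<close> and to \<open>(p, 1)\<close> removes the dependence on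
  that parity: \<open>\<phi> (p, i) = (f p, I p i)\<close>. The arcs from \<open>(p, i)\<close> then say
  \<open>f (p + i) = f p + I p i\<close> and \<open>f (p - i) = f p - I p i\<close>, that is, Jensen's functional equation
  \<open>f (p + i) + f (p - i) = 2 f p\<close>. The increments of \<open>f\<close> are thus constant, so
  \<open>f p = b + m p\<close> and \<open>I p i = m i\<close>, and \<open>m\<close> is a unit because \<open>f\<close> takes the value \<open>b + 1\<close>.
  The argument is uniform in \<open>k\<close> and includes \<open>k = 2\<close>, where the two families of lines coincide.
\<close>

section \<open>The affine group as a semidirect product\<close>

lemma (in cring) semidirect_units_group:
  "group (semidirect_product (add_monoid R) (units_of R) (\<lambda>m x. m \<otimes> x))"
  by (rule group_semidirect_product)
    (auto simp: hom_def r_distr m_assoc units_of_mult units_of_one units_of_carrier Units_closed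
      intro: add.group_axioms units_group)

text \<open>
  The pair \<open>(b, m)\<close> acts as \<open>x \<mapsto> m x + b\<close>; it is recovered from the values at zero and one.
\<close>

lemma (in cring) semidirect_iso_affine_group:
  "semidirect_product (add_monoid R) (units_of R) (\<lambda>m x. m \<otimes> x) \<cong> affine_group R"
proof -
  define aff where "aff = (\<lambda>(b, m). \<lambda>x\<in>carrier R. m \<otimes> x \<oplus> b)"
  let ?S = "semidirect_product (add_monoid R) (units_of R) (\<lambda>m x. m \<otimes> x)"
  have carrier_S: "carrier ?S = carrier R \<times> Units R"
    by (simp add: semidirect_product_def units_of_def)
  have image: "aff ` carrier ?S = affine_maps R"
    unfolding carrier_S affine_maps_def aff_def by force
  have Bij: "f \<in> Bij (carrier R)" if "f \<in> affine_maps R" for f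
    using subgroup.subset[OF affine_maps_subgroup] that by (auto simp: BijGroup_def)
  have "aff \<in> hom ?S (affine_group R)"
  proof (rule homI)
    fix s t assume st: "s \<in> carrier ?S" "t \<in> carrier ?S"
    then have "aff s \<in> Bij (carrier R)" "aff t \<in> Bij (carrier R)"
      using image Bij by blast+
    moreover have "aff (s \<otimes>\<^bsub>?S\<^esub> t) = compose (carrier R) (aff s) (aff t)"
      using st unfolding carrier_S
      by (auto simp: aff_def compose_def semidirect_product_def units_of_def fun_eq_iff
          r_distr m_assoc a_ac Units_closed)
    ultimately show "aff (s \<otimes>\<^bsub>?S\<^esub> t) = aff s \<otimes>\<^bsub>affine_group R\<^esub> aff t"
      by (simp add: affine_group_def BijGroup_def)
  qed (use image in \<open>auto simp: affine_group_def\<close>)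
  moreover have "inj_on aff (carrier ?S)"
  proof (rule inj_onI)
    fix s t assume "s \<in> carrier ?S" "t \<in> carrier ?S" and eq: "aff s = aff t"
    then obtain b m c n where s: "s = (b, m)" "b \<in> carrier R" "m \<in> carrier R"
      and t: "t = (c, n)" "c \<in> carrier R" "n \<in> carrier R"
      by (auto simp: carrier_S Units_closed)
    have "b = c" using fun_cong[OF eq, of \<zero>] s t by (simp add: aff_def)
    moreover have "m \<oplus> b = n \<oplus> c" using fun_cong[OF eq, of \<one>] s t by (simp add: aff_def)
    ultimately show "s = t" using s t by (simp add: add.right_cancel)
  qed
  ultimately have "aff \<in> iso ?S (affine_group R)"
    using image by (simp add: iso_def bij_betw_def affine_group_def)
  then show ?thesis by (rule is_isoI)
qed

section \<open>Arcs modulo an even number\<close>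

locale even_modulus =
  fixes k :: nat
  assumes pos: "k > 0" and even_k: "even k"
begin

text \<open>
  Zk is a constant of its own so that membership in it is an atom for the simplifier
  instead of a pair of inequalities.
\<close>

definition Zk :: "int set" where "Zk = {0..<int k}"
abbreviation Rk :: "int ring" where "Rk \<equiv> residue_ring (int k)"
abbreviation D :: "(int \<times> int) pair_pre_digraph" where "D \<equiv> G_digraph k"
abbreviation SD :: "(int \<times> int) monoid" where
  "SD \<equiv> semidirect_product (add_monoid Rk) (units_of Rk) (\<lambda>m x. m \<otimes>\<^bsub>Rk\<^esub> x)"

definition sign :: "int \<Rightarrow> int" where "sign j = (if even j then 1 else -1)"

lemma k_gt_1: "int k > 1"
  using pos even_k by (cases "k = 1") auto

sublocale res: residues "int k" Rk
  by unfold_locales (use k_gt_1 in auto)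

lemma carrier_Rk: "carrier Rk = Zk"
  by (auto simp: residue_ring_def Zk_def)

lemma pverts_D: "pverts D = Zk \<times> Zk"
  by (simp add: G_digraph_def carrier_Rk Let_def)

lemma mod_Zk [simp]: "x mod int k \<in> Zk"
  using pos by (simp add: Zk_def)

lemma mod_Zk_ident [simp]: "x \<in> Zk \<Longrightarrow> x mod int k = x"
  by (simp add: Zk_def)

lemma zero_one_Zk [simp]: "0 \<in> Zk" "1 \<in> Zk"
  using k_gt_1 by (auto simp: Zk_def)

lemma Zk_cong_eq: "x \<in> Zk \<Longrightarrow> y \<in> Zk \<Longrightarrow> [x = y] (mod int k) \<Longrightarrow> x = y"
  by (simp add: cong_def Zk_def)

lemma cong_even_iff: "[x = y] (mod int k) \<Longrightarrow> even x \<longleftrightarrow> even y"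
  by (metis even_k cong_dvd_iff cong_dvd_modulus even_of_nat)

lemma mod_add_mult_mod:
  fixes x y z n :: int
  shows "(x + y * (z mod n)) mod n = (x + y * z) mod n"
    and "(x + (z mod n) * y) mod n = (x + z * y) mod n"
  by (metis mod_add_right_eq mod_mult_right_eq mult.commute)+

lemma sign_cong: "[i = j] (mod int k) \<Longrightarrow> sign i = sign j"
  using cong_even_iff by (simp add: sign_def)

lemma arc_iff:
  assumes "p \<in> Zk" "i \<in> Zk" "q \<in> Zk" "j \<in> Zk"
  shows "((p, i), (q, j)) \<in> parcs D \<longleftrightarrow> [q = p + sign j * i] (mod int k)"
proof -
  have "(-1) ^ nat j = sign j" using assms by (simp add: Zk_def sign_def minus_one_power_iff even_nat_iff)
  then show ?thesis using assms
    by (auto simp: G_digraph_def carrier_Rk Let_def cong_def)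
qed

section \<open>Reading parities off common in-neighbours\<close>

definition common_in :: "int \<times> int \<Rightarrow> int \<times> int \<Rightarrow> bool" where
  "common_in v w \<longleftrightarrow> (\<exists>u\<in>pverts D. (u, v) \<in> parcs D \<and> (u, w) \<in> parcs D)"

text \<open>
  Having a common in-neighbour is not transitive; two steps of it are what it takes to compare
  the parities of first coordinates independently of the second coordinates.
\<close>

definition linked :: "int \<times> int \<Rightarrow> int \<times> int \<Rightarrow> bool" where
  "linked v w \<longleftrightarrow> (\<exists>u\<in>pverts D. common_in v u \<and> common_in u w)"

text \<open>
  The in-neighbours of \<open>(p, i)\<close> are the points \<open>(a, x)\<close> of the line \<open>a + sign i * x = p\<close>, so
  this describes when two such lines meet.
\<close>

lemma common_in_iff:
  assumes "p \<in> Zk" "i \<in> Zk" "q \<in> Zk" "j \<in> Zk"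
  shows "common_in (p, i) (q, j) \<longleftrightarrow> (if even i = even j then p = q else even (p - q))"
    (is "_ \<longleftrightarrow> ?R")
proof
  assume "common_in (p, i) (q, j)"
  then obtain a x where "a \<in> Zk" "x \<in> Zk"
    and "((a, x), (p, i)) \<in> parcs D" "((a, x), (q, j)) \<in> parcs D"
    by (auto simp: common_in_def pverts_D)
  then have "[p = a + sign i * x] (mod int k)" "[q = a + sign j * x] (mod int k)"
    using assms by (simp_all add: arc_iff)
  then have diff: "[p - q = (a + sign i * x) - (a + sign j * x)] (mod int k)"
    by (rule cong_diff)
  show ?R
  proof (cases "even i = even j")
    case True
    then have "[p = q] (mod int k)" using diff by (simp add: sign_def cong_diff_iff_cong_0)
    then show ?thesis using True assms Zk_cong_eq by simp
  next
    case False
    then have "even ((a + sign i * x) - (a + sign j * x))" by (simp add: sign_def)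
    then show ?thesis using False cong_even_iff[OF diff] by simp
  qed
next
  assume R: ?R
  show "common_in (p, i) (q, j)"
  proof (cases "even i = even j")
    case True
    then have "((p, 0), (p, i)) \<in> parcs D" "((p, 0), (q, j)) \<in> parcs D"
      using R assms by (simp_all add: arc_iff)
    then show ?thesis using assms unfolding common_in_def pverts_D by (intro bexI[of _ "(p, 0)"]) auto
  next
    case False
    then obtain h where h: "p - q = 2 * h" using R by (auto elim: evenE simp del: even_diff_iff even_diff)
    \<comment> \<open>Intersection of the two lines: \<open>a = (p + q) / 2\<close> and \<open>x = \<plusminus>(p - q) / 2\<close>.\<close>
    let ?a = "(q + h) mod int k" and ?x = "(sign i * h) mod int k"
    have arc: "((?a, ?x), (r, l)) \<in> parcs D"
      if "r \<in> Zk" "l \<in> Zk" "r = q + h + sign l * (sign i * h)" for r l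
    proof -
      have "[q + h + sign l * (sign i * h) = ?a + sign l * ?x] (mod int k)"
        by (intro cong_add cong_mult) (simp_all add: cong_def)
      then show ?thesis using that arc_iff by simp
    qed
    have "((?a, ?x), (p, i)) \<in> parcs D" "((?a, ?x), (q, j)) \<in> parcs D"
      using False h assms by (intro arc; simp add: sign_def)+
    then show ?thesis unfolding common_in_def pverts_D by (intro bexI[of _ "(?a, ?x)"]) auto
  qed
qed

lemma linked_iff:
  assumes "p \<in> Zk" "i \<in> Zk" "q \<in> Zk" "j \<in> Zk"
  shows "linked (p, i) (q, j) \<longleftrightarrow> even (p - q)"
proof
  assume "linked (p, i) (q, j)"
  then obtain r l where "r \<in> Zk" "l \<in> Zk" "common_in (p, i) (r, l)" "common_in (r, l) (q, j)"
    by (auto simp: linked_def pverts_D)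
  then have "even (p - r)" "even (r - q)"
    using assms by (auto simp: common_in_iff split: if_splits)
  then show "even (p - q)" by simp
next
  assume pq: "even (p - q)"
  \<comment> \<open>A second coordinate of parity opposite to \<open>j\<close> makes the last step depend on parity alone;
    the first step stays on \<open>p\<close>, so it exists for either parity of \<open>i\<close>.\<close>
  let ?l = "if even j then 1 else 0 :: int"
  have "common_in (p, i) (p, ?l)" "common_in (p, ?l) (q, j)"
    using assms pq by (auto simp: common_in_iff)
  then show "linked (p, i) (q, j)"
    using assms unfolding linked_def pverts_D by (intro bexI[of _ "(p, ?l)"]) auto
qed

text \<open>
  The first coordinate changes by \<open>\<plusminus>i\<close> along any arc from \<open>(p, i)\<close>, so the parity of \<open>i\<close>
  is a property of the digraph.
\<close>

lemma arc_linked_iff: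
  assumes "u \<in> pverts D" "v \<in> pverts D" "(u, v) \<in> parcs D"
  shows "linked u v \<longleftrightarrow> even (snd u)"
proof -
  obtain p i q j where u: "u = (p, i)" "p \<in> Zk" "i \<in> Zk" and v: "v = (q, j)" "q \<in> Zk" "j \<in> Zk"
    using assms by (auto simp: pverts_D)
  have "even q \<longleftrightarrow> even (p + sign j * i)"
    using assms u v arc_iff cong_even_iff by blast
  then show ?thesis using u v by (auto simp: linked_iff sign_def split: if_splits)
qed

section \<open>Affine maps as automorphisms\<close>

text \<open>
  The affine map \<open>p \<mapsto> b + m p\<close> on positions, together with its linear part on steps.
\<close>

definition lift :: "int \<times> int \<Rightarrow> int \<times> int \<Rightarrow> int \<times> int" where
  "lift = (\<lambda>(b, m). \<lambda>(p, i)\<in>Zk \<times> Zk. ((b + m * p) mod int k, (m * i) mod int k))"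

lemma lift_apply:
  "p \<in> Zk \<Longrightarrow> i \<in> Zk \<Longrightarrow> lift (b, m) (p, i) = ((b + m * p) mod int k, (m * i) mod int k)"
  by (simp add: lift_def)

lemma carrier_SD: "carrier SD = Zk \<times> {m \<in> Zk. coprime m (int k)}"
proof -
  have "m \<noteq> 0" if "coprime m (int k)" for m
    using that k_gt_1 by auto
  then have "Units Rk = {m \<in> Zk. coprime m (int k)}"
    unfolding res.res_units_eq Zk_def by force
  then show ?thesis by (simp add: semidirect_product_def units_of_def carrier_Rk)
qed

text \<open>
  Arcs are respected in both directions because \<open>m\<close> can be cancelled and, being odd,
  leaves the parity of \<open>j\<close>, hence the sign in the arc, unchanged.
\<close>

lemma lift_automorphism:
  assumes "s \<in> carrier SD"
  shows "lift s \<in> digraph_automorphisms D"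
proof -
  obtain b m where s: "s = (b, m)" and m: "m \<in> Zk" "coprime m (int k)"
    using assms unfolding carrier_SD by auto
  have "odd m" using m even_k by (metis coprime_common_divisor even_of_nat odd_one)
  have inj: "inj_on (lift s) (Zk \<times> Zk)"
  proof (rule inj_onI, clarify)
    fix p i q j assume *: "p \<in> Zk" "i \<in> Zk" "q \<in> Zk" "j \<in> Zk" "lift s (p, i) = lift s (q, j)"
    then have "[b + m * p = b + m * q] (mod int k)" "[m * i = m * j] (mod int k)"
      by (simp_all add: s lift_apply cong_def)
    then have "[p = q] (mod int k)" "[i = j] (mod int k)"
      using m by (simp_all add: cong_add_lcancel cong_mult_lcancel)
    then show "p = q \<and> i = j" using * Zk_cong_eq by blast
  qed
  have "lift s ` (Zk \<times> Zk) \<subseteq> Zk \<times> Zk" by (auto simp: s lift_apply)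
  then have "bij_betw (lift s) (Zk \<times> Zk) (Zk \<times> Zk)"
    using inj by (simp add: bij_betw_def endo_inj_surj Zk_def)
  then have Bij: "lift s \<in> Bij (pverts D)"
    by (simp add: Bij_def pverts_D s lift_def)
  have "((p, i), (q, j)) \<in> parcs D \<longleftrightarrow> (lift s (p, i), lift s (q, j)) \<in> parcs D"
    if *: "p \<in> Zk" "i \<in> Zk" "q \<in> Zk" "j \<in> Zk" for p i q j
  proof -
    have sg: "sign (m * j mod int k) = sign j"
      using sign_cong[of "m * j mod int k" "m * j"] \<open>odd m\<close> by (simp add: sign_def cong_def)
    have "(lift s (p, i), lift s (q, j)) \<in> parcs D \<longleftrightarrow>
        [(b + m * q) mod int k = (b + m * p) mod int k + sign j * (m * i mod int k)] (mod int k)"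
      using * by (simp add: s lift_apply arc_iff sg)
    also have "\<dots> \<longleftrightarrow> [b + m * q = b + m * p + sign j * (m * i)] (mod int k)"
      by (simp add: cong_def mod_simps mod_add_mult_mod)
    also have "b + m * p + sign j * (m * i) = b + m * (p + sign j * i)"
      by (simp add: algebra_simps)
    also have "[b + m * q = \<dots>] (mod int k) \<longleftrightarrow> [q = p + sign j * i] (mod int k)"
      using m by (simp add: cong_add_lcancel cong_mult_lcancel)
    finally show ?thesis using * by (simp add: arc_iff)
  qed
  then show ?thesis using Bij by (simp add: digraph_automorphisms_def pverts_D)
qed

section \<open>Every automorphism is affine\<close>

text \<open>
  An automorphism preserves \<open>common_in\<close> and \<open>linked\<close>, hence the parity of the second
  coordinate and the fibres of the first coordinate within each parity. The arcs then turn into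
  functional equations whose only solutions are affine.
\<close>

lemma automorphism_is_lift:
  assumes "\<phi> \<in> digraph_automorphisms D"
  shows "\<exists>s\<in>carrier SD. \<phi> = lift s"
proof -
  have bij: "bij_betw \<phi> (pverts D) (pverts D)" and ext: "\<phi> \<in> extensional (pverts D)"
    and arc: "\<And>u v. u \<in> pverts D \<Longrightarrow> v \<in> pverts D \<Longrightarrow>
      (u, v) \<in> parcs D \<longleftrightarrow> (\<phi> u, \<phi> v) \<in> parcs D"
    using assms by (auto simp: digraph_automorphisms_def Bij_def)
  have mem: "\<phi> v \<in> pverts D" if "v \<in> pverts D" for v
    using bij that by (auto simp: bij_betw_def)
  have ex: "(\<exists>u\<in>pverts D. P u) \<longleftrightarrow> (\<exists>u\<in>pverts D. P (\<phi> u))" for P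
    using bij unfolding bij_betw_def by (metis imageE imageI)
  have common: "common_in (\<phi> v) (\<phi> w) \<longleftrightarrow> common_in v w"
    if "v \<in> pverts D" "w \<in> pverts D" for v w
    unfolding common_in_def ex[of "\<lambda>u. (u, \<phi> v) \<in> parcs D \<and> (u, \<phi> w) \<in> parcs D"]
    using arc that by auto
  have linked: "linked (\<phi> v) (\<phi> w) \<longleftrightarrow> linked v w"
    if "v \<in> pverts D" "w \<in> pverts D" for v w
    unfolding linked_def ex[of "\<lambda>u. common_in (\<phi> v) u \<and> common_in u (\<phi> w)"]
    using common that by auto
  define P where "P p i = fst (\<phi> (p, i))" for p i
  define I where "I p i = snd (\<phi> (p, i))" for p i
  define f where "f p = P p 0" for p
  have \<phi>: "\<phi> (p, i) = (P p i, I p i)" for p i by (simp add: P_def I_def)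
  have PI: "P p i \<in> Zk" "I p i \<in> Zk" if "p \<in> Zk" "i \<in> Zk" for p i
    using mem[of "(p, i)"] that by (auto simp: \<phi> pverts_D)
  have parity: "even (I p i) \<longleftrightarrow> even i" if pi: "p \<in> Zk" "i \<in> Zk" for p i
  proof -
    let ?w = "((p + i) mod int k, 0)"
    have V: "(p, i) \<in> pverts D" "?w \<in> pverts D" using pi pos by (auto simp: pverts_D)
    have a: "((p, i), ?w) \<in> parcs D"
      using pi by (simp add: arc_iff sign_def cong_def)
    then have "(\<phi> (p, i), \<phi> ?w) \<in> parcs D" using arc V by blast
    then have "linked (\<phi> (p, i)) (\<phi> ?w) \<longleftrightarrow> even (I p i)"
      using arc_linked_iff V mem by (simp add: I_def)
    then show ?thesis using linked V arc_linked_iff[OF V a] by simp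
  qed
  have P_eq: "P p i = P p j" if "p \<in> Zk" "i \<in> Zk" "j \<in> Zk" "even i = even j" for p i j
  proof -
    have "common_in (\<phi> (p, i)) (\<phi> (p, j))"
      using that common by (simp add: pverts_D common_in_iff)
    then show ?thesis using that parity PI by (simp add: \<phi> common_in_iff)
  qed
  have step: "[P ((p + sign j * i) mod int k) j = P p i + sign j * I p i] (mod int k)"
    if "p \<in> Zk" "i \<in> Zk" "j \<in> Zk" for p i j
  proof -
    let ?q = "(p + sign j * i) mod int k"
    have "((p, i), (?q, j)) \<in> parcs D"
      using that by (simp add: arc_iff cong_def)
    then have "(\<phi> (p, i), \<phi> (?q, j)) \<in> parcs D"
      using arc that mod_Zk by (simp add: pverts_D)
    moreover have "sign (I ?q j) = sign j" using parity that mod_Zk by (simp add: sign_def)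
    ultimately show ?thesis
      using that PI mod_Zk by (simp add: \<phi> arc_iff)
  qed
  have I0: "I p 0 = 0" if p: "p \<in> Zk" for p
  proof -
    have "[P p 0 = P p 0 + I p 0] (mod int k)"
      using step[of p 0 0] p by (simp add: sign_def)
    then have "[I p 0 = 0] (mod int k)"
      using cong_add_lcancel_0 cong_sym by blast
    then show ?thesis using Zk_cong_eq PI p by simp
  qed
  \<comment> \<open>\<open>P_eq\<close> only compares second coordinates of equal parity; the arc from \<open>(p, 0)\<close> to
    \<open>(p, 1)\<close> bridges the two parities.\<close>
  have P: "P p i = f p" if p: "p \<in> Zk" and i: "i \<in> Zk" for p i
  proof -
    have "[P p 1 = P p 0] (mod int k)" using step[of p 0 1] p I0 by (simp add: sign_def)
    then have "P p 1 = P p 0" using Zk_cong_eq PI p zero_one_Zk by blast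
    then show ?thesis
      using P_eq[OF p i, of 0] P_eq[OF p i, of 1] zero_one_Zk unfolding f_def
      by (cases "even i") simp_all
  qed
  have f_Zk: "f p \<in> Zk" if "p \<in> Zk" for p using PI that unfolding f_def by simp
  have plus: "[f ((p + i) mod int k) = f p + I p i] (mod int k)" if "p \<in> Zk" "i \<in> Zk" for p i
    using step[of p i 0] that P mod_Zk by (simp add: sign_def)
  have minus: "[f ((p - i) mod int k) = f p - I p i] (mod int k)" if "p \<in> Zk" "i \<in> Zk" for p i
    using step[of p i 1] that P mod_Zk by (simp add: sign_def)
  define m where "m = I 0 1"
  have m: "m \<in> Zk" unfolding m_def using PI by simp
  \<comment> \<open>The step from \<open>p\<close> to \<open>p + 1\<close> is \<open>I p 1\<close> by \<open>plus\<close> and \<open>I (p + 1) 1\<close> by \<open>minus\<close>, so all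
    increments equal the one at zero.\<close>
  have up: "[f p = f 0 + m * p] (mod int k) \<and> I p 1 = m"
    if "0 \<le> p" "p < int k" for p
    using that
  proof (induction p rule: int_ge_induct)
    case base
    then show ?case by (simp add: m_def)
  next
    case (step p)
    then have p: "p \<in> Zk" "p + 1 \<in> Zk" by (auto simp: Zk_def)
    have IH: "[f p = f 0 + m * p] (mod int k)" "I p 1 = m" using step by auto
    have f1: "[f (p + 1) = f p + m] (mod int k)" using plus[of p 1] p IH by simp
    have "[f p = f (p + 1) - I (p + 1) 1] (mod int k)" using minus[of "p + 1" 1] p by simp
    then have "[f p + I (p + 1) 1 = f (p + 1)] (mod int k)"
      using cong_add[OF _ cong_refl, of "f p" _ "int k" "I (p + 1) 1"] by fastforce
    then have "[f p + I (p + 1) 1 = f p + m] (mod int k)" using f1 cong_trans by blast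
    then have "[I (p + 1) 1 = m] (mod int k)" using cong_add_lcancel by blast
    then have "I (p + 1) 1 = m" using Zk_cong_eq PI p m by simp
    moreover have "[f (p + 1) = (f 0 + m * p) + m] (mod int k)"
      using f1 IH(1) cong_add[OF IH(1) cong_refl] cong_trans by blast
    ultimately show ?case by (simp add: algebra_simps)
  qed
  have f_affine: "[f p = f 0 + m * p] (mod int k)" if "p \<in> Zk" for p
    using up[of p] that by (simp add: Zk_def)
  have f_mod: "[f (x mod int k) = f 0 + m * x] (mod int k)" for x
    using f_affine[of "x mod int k"] mod_Zk
    by (simp add: cong_def mod_add_mult_mod)
  have I: "[I p i = m * i] (mod int k)" if "p \<in> Zk" "i \<in> Zk" for p i
  proof -
    have "[f p + I p i = f 0 + m * (p + i)] (mod int k)"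
      using plus[OF that] f_mod cong_sym cong_trans by blast
    then have "[f p + I p i - f p = (f 0 + m * (p + i)) - (f 0 + m * p)] (mod int k)"
      using f_affine that by (intro cong_diff) auto
    then show ?thesis by (simp add: algebra_simps)
  qed
  \<comment> \<open>A position that \<open>f\<close> sends to \<open>f 0 + 1\<close> is an inverse of \<open>m\<close>.\<close>
  have "coprime m (int k)"
  proof -
    have "((f 0 + 1) mod int k, 0) \<in> \<phi> ` pverts D"
      using bij mod_Zk zero_one_Zk by (simp add: bij_betw_def pverts_D)
    then obtain p i where "p \<in> Zk" "i \<in> Zk" "P p i = (f 0 + 1) mod int k"
      by (auto simp: \<phi> pverts_D)
    then have "p \<in> Zk" "f p = (f 0 + 1) mod int k" using P by auto
    then have "[f 0 + m * p = f 0 + 1] (mod int k)"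
      using f_affine[of p] by (simp add: cong_def)
    then have "[m * p = 1] (mod int k)" using cong_add_lcancel by blast
    then show ?thesis using coprime_iff_invertible_int by blast
  qed
  then have "(f 0, m) \<in> carrier SD" using m f_Zk unfolding carrier_SD by simp
  moreover have "\<phi> = lift (f 0, m)"
  proof (rule extensionalityI[OF ext])
    show "lift (f 0, m) \<in> extensional (pverts D)" by (simp add: lift_def pverts_D)
    fix v assume "v \<in> pverts D"
    then obtain p i where v: "v = (p, i)" and pi: "p \<in> Zk" "i \<in> Zk" by (auto simp: pverts_D)
    have "f p = (f 0 + m * p) mod int k"
      using Zk_cong_eq[OF f_Zk[OF pi(1)] mod_Zk] f_affine[OF pi(1)] by (simp add: cong_def)
    moreover have "I p i = m * i mod int k"
      using Zk_cong_eq[OF PI(2)[OF pi] mod_Zk] I[OF pi] by (simp add: cong_def)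
    ultimately show "\<phi> v = lift (f 0, m) v" using P pi by (simp add: v \<phi> lift_apply)
  qed
  ultimately show ?thesis by blast
qed

section \<open>The automorphism group\<close>

lemma semidirect_iso_aut: "SD \<cong> digraph_aut_group D"
proof -
  have image: "lift ` carrier SD = digraph_automorphisms D"
    using lift_automorphism automorphism_is_lift by blast
  have "lift \<in> hom SD (digraph_aut_group D)"
  proof (rule homI)
    fix s t assume st: "s \<in> carrier SD" "t \<in> carrier SD"
    obtain b m c n where eq: "s = (b, m)" "t = (c, n)" by (cases s, cases t)
    have "s \<otimes>\<^bsub>SD\<^esub> t = ((b + m * c) mod int k, m * n mod int k)"
      by (simp add: eq semidirect_product_def units_of_def residue_ring_def mod_simps)
    moreover have "lift s \<in> Bij (pverts D)" "lift t \<in> Bij (pverts D)"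
      using st lift_automorphism by (auto simp: digraph_automorphisms_def)
    moreover have "lift ((b + m * c) mod int k, m * n mod int k)
        = compose (Zk \<times> Zk) (lift s) (lift t)"
      by (auto simp: fun_eq_iff eq compose_def lift_def mod_simps mod_add_mult_mod)
        (simp_all add: algebra_simps)
    ultimately show "lift (s \<otimes>\<^bsub>SD\<^esub> t) = lift s \<otimes>\<^bsub>digraph_aut_group D\<^esub> lift t"
      by (simp add: digraph_aut_group_def BijGroup_def pverts_D)
  qed (use lift_automorphism in \<open>simp add: digraph_aut_group_def\<close>)
  moreover have "inj_on lift (carrier SD)"
  proof (rule inj_onI)
    fix s t assume st: "s \<in> carrier SD" "t \<in> carrier SD" and eq: "lift s = lift t"
    then obtain b m c n where s: "s = (b, m)" "b \<in> Zk" "m \<in> Zk"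
      and t: "t = (c, n)" "c \<in> Zk" "n \<in> Zk" unfolding carrier_SD by auto
    show "s = t"
      using fun_cong[OF eq, of "(0, 1)"] s t by (simp add: lift_apply)
  qed
  ultimately have "lift \<in> iso SD (digraph_aut_group D)"
    using image by (simp add: iso_def bij_betw_def digraph_aut_group_def)
  then show ?thesis by (rule is_isoI)
qed

end

theorem theorem6:
  fixes k :: nat
  assumes "k > 0" and "even k"
  shows "digraph_aut_group (G_digraph k) \<cong> affine_group (residue_ring (int k)) \<and>
    digraph_aut_group (G_digraph k) \<cong>
      semidirect_product (add_monoid (residue_ring (int k))) (units_of (residue_ring (int k)))
        (\<lambda>m x. m \<otimes>\<^bsub>residue_ring (int k)\<^esub> x)"
proof -
  interpret even_modulus k by unfold_locales (use assms in auto)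
  have "digraph_aut_group D \<cong> SD"
    using group.iso_sym[OF res.semidirect_units_group semidirect_iso_aut] .
  moreover have "SD \<cong> affine_group Rk" by (rule res.semidirect_iso_affine_group)
  ultimately show ?thesis using iso_trans by blast
qed

end
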